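(* Let $X$ be a path connected metric space and $x_0\in X$. If $\pi_1^{qtop}(X,x_0)$ is a $T_2$ $k_\omega$-group, then $\pi_1^{qtop}(X,x_0)$ is a topological group. Moreover, if $X$ is compact, then $\pi_1^{qtop}(X,x_0)$ is $T_4$.
   Context: $\Omega(X,x_0)$ denotes the space of loops $[0,1]\to X$ based at $x_0$ with the compact-open topology. $\pi_1^{qtop}(X,x_0)$ is $\pi_1(X,x_0)$ endowed with the quotient topology with respect to the map $\pi:\Omega(X,x_0)\to\pi_1(X,x_0)$, $\pi(\alpha)=[\alpha]$. It is a quasitopological group, i.e. a group with a topology such that inversion is continuous and multiplication is continuous in each variable separately. A space $Y$ is a $k_\omega$-space if it is the inductive (direct) limit of a sequence $Y_1\subset Y_2\subset Y_3\subset\cdots$ of compact subspaces; equivalently, $Y=\bigcup_n Y_n$ has the weak topology with respect to the nested subsets $\{Y_n\}$. A $k_\omega$-group is a quasitopological group whose underlying space is a $k_\omega$-space. $T_4$ means normal and $T_2$. The "moreover" sentence keeps the hypothesis that $\pi_1^{qtop}(X,x_0)$ is a $T_2$ $k_\omega$-group. *)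

theory Defs
  imports "HOL-Analysis.Analysis" "HOL-Algebra.Group"
begin

section \<open>Compact-open and quotient topologies\<close>

text \<open>Maps are extensional (equal to \<^const>\<open>undefined\<close> outside the domain), so each continuous map
  \<open>S \<rightarrow> T\<close> is represented by exactly one point.  Taking \<open>K = {}\<close> shows that the subbasis covers the
  whole set of maps.\<close>

definition compact_open_topology :: "'a topology \<Rightarrow> 'b topology \<Rightarrow> ('a \<Rightarrow> 'b) topology" where
  "compact_open_topology S T = topology_generated_by
     {{f \<in> extensional (topspace S). continuous_map S T f \<and> f ` K \<subseteq> U} | K U.
        compactin S K \<and> openin T U}"

definition quotient_topology :: "'a topology \<Rightarrow> ('a \<Rightarrow> 'b) \<Rightarrow> 'b topology" where
  "quotient_topology T q =
     topology (\<lambda>V. V \<subseteq> q ` topspace T \<and> openin T {x \<in> topspace T. q x \<in> V})"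

lemma topspace_compact_open_topology:
  "topspace (compact_open_topology S T) = {f \<in> extensional (topspace S). continuous_map S T f}"
  unfolding compact_open_topology_def topology_generated_by_topspace
proof (intro equalityI subsetI)
  fix f assume "f \<in> {f \<in> extensional (topspace S). continuous_map S T f}"
  then show "f \<in> \<Union> {{f \<in> extensional (topspace S). continuous_map S T f \<and> f ` K \<subseteq> U} | K U.
        compactin S K \<and> openin T U}"
    by (intro UnionI[where X = "{f \<in> extensional (topspace S). continuous_map S T f \<and> f ` {} \<subseteq> {}}"])
       (auto intro!: exI[where x = "{}"])
qed auto

lemma openin_quotient_topology:
  "openin (quotient_topology T q) V \<longleftrightarrow>
     V \<subseteq> q ` topspace T \<and> openin T {x \<in> topspace T. q x \<in> V}"
proof -
  have "istopology (\<lambda>V. V \<subseteq> q ` topspace T \<and> openin T {x \<in> topspace T. q x \<in> V})"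
    unfolding istopology_def
  proof (intro conjI allI impI)
    fix A B assume A: "A \<subseteq> q ` topspace T \<and> openin T {x \<in> topspace T. q x \<in> A}"
      and B: "B \<subseteq> q ` topspace T \<and> openin T {x \<in> topspace T. q x \<in> B}"
    show "A \<inter> B \<subseteq> q ` topspace T" using A by blast
    have "{x \<in> topspace T. q x \<in> A \<inter> B} =
        {x \<in> topspace T. q x \<in> A} \<inter> {x \<in> topspace T. q x \<in> B}" by blast
    then show "openin T {x \<in> topspace T. q x \<in> A \<inter> B}" using A B by auto
  next
    fix \<K> assume K: "\<forall>A\<in>\<K>. A \<subseteq> q ` topspace T \<and> openin T {x \<in> topspace T. q x \<in> A}"
    show "\<Union>\<K> \<subseteq> q ` topspace T" using K by blast
    have "{x \<in> topspace T. q x \<in> \<Union>\<K>} = (\<Union>A\<in>\<K>. {x \<in> topspace T. q x \<in> A})" by blast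
    then show "openin T {x \<in> topspace T. q x \<in> \<Union>\<K>}" using K by auto
  qed
  then show ?thesis unfolding quotient_topology_def by (simp add: topology_inverse')
qed

lemma topspace_quotient_topology: "topspace (quotient_topology T q) = q ` topspace T"
proof (rule equalityI)
  show "topspace (quotient_topology T q) \<subseteq> q ` topspace T"
    using openin_quotient_topology[of T q] by (metis openin_topspace)
  have "{x \<in> topspace T. q x \<in> q ` topspace T} = topspace T" by blast
  then have "openin (quotient_topology T q) (q ` topspace T)"
    by (simp add: openin_quotient_topology)
  then show "q ` topspace T \<subseteq> topspace (quotient_topology T q)"
    by (rule openin_subset)
qed

lemma quotient_map_quotient_topology: "quotient_map T (quotient_topology T q) q"
  unfolding quotient_map_def by (auto simp: topspace_quotient_topology openin_quotient_topology)


section \<open>The fundamental group with the quotient topology\<close>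

definition loop_space :: "'a::topological_space set \<Rightarrow> 'a \<Rightarrow> (real \<Rightarrow> 'a) topology" where
  "loop_space X x0 = subtopology (compact_open_topology (top_of_set {0..1}) (top_of_set X))
     {p. pathstart p = x0 \<and> pathfinish p = x0}"

definition loop_class :: "'a::topological_space set \<Rightarrow> 'a \<Rightarrow> (real \<Rightarrow> 'a) \<Rightarrow> (real \<Rightarrow> 'a) set" where
  "loop_class X x0 p = {q \<in> topspace (loop_space X x0). homotopic_paths X p q}"

text \<open>A concatenation \<open>p +++ q\<close> need not be extensional, but \<^const>\<open>loop_class\<close> only depends on its
  values on \<open>{0..1}\<close>.  The classes occurring in the union below all coincide; see
  \<open>fundamental_group_mult\<close>.\<close>

definition fundamental_group :: "'a::topological_space set \<Rightarrow> 'a \<Rightarrow> (real \<Rightarrow> 'a) set monoid" where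
  "fundamental_group X x0 =
     \<lparr>carrier = loop_class X x0 ` topspace (loop_space X x0),
      mult = (\<lambda>A B. \<Union>p\<in>A. \<Union>q\<in>B. loop_class X x0 (p +++ q)),
      one = loop_class X x0 (\<lambda>t. x0)\<rparr>"

definition pi1_qtop :: "'a::topological_space set \<Rightarrow> 'a \<Rightarrow> (real \<Rightarrow> 'a) set topology" where
  "pi1_qtop X x0 = quotient_topology (loop_space X x0) (loop_class X x0)"

lemma topspace_loop_space:
  "p \<in> topspace (loop_space X x0) \<longleftrightarrow>
     p \<in> extensional {0..1} \<and> path p \<and> path_image p \<subseteq> X \<and> pathstart p = x0 \<and> pathfinish p = x0"
  by (auto simp: loop_space_def topspace_compact_open_topology path_def path_image_def)

lemma topspace_pi1_qtop: "topspace (pi1_qtop X x0) = carrier (fundamental_group X x0)"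
  by (simp add: pi1_qtop_def topspace_quotient_topology fundamental_group_def)

lemma quotient_map_pi1_qtop: "quotient_map (loop_space X x0) (pi1_qtop X x0) (loop_class X x0)"
  by (simp add: pi1_qtop_def quotient_map_quotient_topology)

lemma loop_class_cong:
  assumes "homotopic_paths X p q" shows "loop_class X x0 p = loop_class X x0 q"
  using assms unfolding loop_class_def by (meson homotopic_paths_sym homotopic_paths_trans)

lemma loop_class_eq_iff:
  assumes "path p" "path_image p \<subseteq> X" "path q" "path_image q \<subseteq> X"
    and "pathstart q = x0" "pathfinish q = x0"
  shows "loop_class X x0 p = loop_class X x0 q \<longleftrightarrow> homotopic_paths X p q"
proof
  let ?r = "restrict q {0..1}"
  have qr: "homotopic_paths X q ?r"
    using assms by (intro homotopic_paths_eq) auto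
  then have "?r \<in> loop_class X x0 q"
    using assms homotopic_paths_imp_path[OF qr] homotopic_paths_imp_subset[OF qr]
      homotopic_paths_imp_pathstart[OF qr] homotopic_paths_imp_pathfinish[OF qr]
    by (simp add: loop_class_def topspace_loop_space)
  moreover assume "loop_class X x0 p = loop_class X x0 q"
  ultimately have "?r \<in> loop_class X x0 p" by metis
  then have "homotopic_paths X p ?r" by (simp add: loop_class_def)
  then show "homotopic_paths X p q" using qr homotopic_paths_sym homotopic_paths_trans by blast
qed (rule loop_class_cong)

lemma loop_class_in_carrier:
  assumes "path p" "path_image p \<subseteq> X" "pathstart p = x0" "pathfinish p = x0"
  shows "loop_class X x0 p \<in> carrier (fundamental_group X x0)"
proof -
  let ?r = "restrict p {0..1}"
  have pr: "homotopic_paths X p ?r"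
    using assms by (intro homotopic_paths_eq) auto
  then have "?r \<in> topspace (loop_space X x0)"
    using assms homotopic_paths_imp_path[OF pr] homotopic_paths_imp_subset[OF pr]
      homotopic_paths_imp_pathstart[OF pr] homotopic_paths_imp_pathfinish[OF pr]
    by (simp add: topspace_loop_space)
  then show ?thesis using loop_class_cong[OF pr] by (simp add: fundamental_group_def)
qed

lemma fundamental_group_mult:
  assumes p: "path p" "path_image p \<subseteq> X" "pathstart p = x0" "pathfinish p = x0"
    and q: "path q" "path_image q \<subseteq> X" "pathstart q = x0" "pathfinish q = x0"
  shows "loop_class X x0 p \<otimes>\<^bsub>fundamental_group X x0\<^esub> loop_class X x0 q = loop_class X x0 (p +++ q)"
proof -
  have ne: "loop_class X x0 r \<noteq> {}"
    if "path r" "path_image r \<subseteq> X" "pathstart r = x0" "pathfinish r = x0" for r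
    using loop_class_in_carrier[OF that] homotopic_paths_refl
    by (fastforce simp: fundamental_group_def loop_class_def topspace_loop_space)
  have "loop_class X x0 (r +++ s) = loop_class X x0 (p +++ q)"
    if "r \<in> loop_class X x0 p" "s \<in> loop_class X x0 q" for r s
  proof -
    have "homotopic_paths X (p +++ q) (r +++ s)"
      using that p q by (intro homotopic_paths_join) (auto simp: loop_class_def)
    then show ?thesis using loop_class_cong by metis
  qed
  then show ?thesis
    using ne[OF p] ne[OF q] by (simp add: fundamental_group_def)
qed

lemma group_fundamental_group:
  assumes "x0 \<in> X"
  shows "group (fundamental_group X x0)"
proof (rule groupI)
  let ?G = "fundamental_group X x0" and ?c = "loop_class X x0"
  define L where "L p \<longleftrightarrow> path p \<and> path_image p \<subseteq> X \<and> pathstart p = x0 \<and> pathfinish p = x0" for p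
  have rep: "\<exists>p. L p \<and> A = ?c p" if "A \<in> carrier ?G" for A
    using that by (auto simp: fundamental_group_def topspace_loop_space L_def)
  have car: "?c p \<in> carrier ?G" if "L p" for p
    using that loop_class_in_carrier by (auto simp: L_def)
  have mul: "?c p \<otimes>\<^bsub>?G\<^esub> ?c q = ?c (p +++ q)" if "L p" "L q" for p q
    using that unfolding L_def by (intro fundamental_group_mult) simp_all
  have Lj: "L (p +++ q)" if "L p" "L q" for p q
    using that by (auto simp: L_def path_image_join)
  have one: "\<one>\<^bsub>?G\<^esub> = ?c (\<lambda>t. x0)" by (simp add: fundamental_group_def)
  have L1: "L (\<lambda>t. x0)"
    using assms by (auto simp: L_def path_def path_image_def pathstart_def pathfinish_def)
  show "\<one>\<^bsub>?G\<^esub> \<in> carrier ?G" using one car[OF L1] by simp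
  show "A \<otimes>\<^bsub>?G\<^esub> B \<in> carrier ?G" if "A \<in> carrier ?G" "B \<in> carrier ?G" for A B
    using rep[OF that(1)] rep[OF that(2)] mul Lj car by fastforce
  show "A \<otimes>\<^bsub>?G\<^esub> B \<otimes>\<^bsub>?G\<^esub> C = A \<otimes>\<^bsub>?G\<^esub> (B \<otimes>\<^bsub>?G\<^esub> C)"
    if ABC: "A \<in> carrier ?G" "B \<in> carrier ?G" "C \<in> carrier ?G" for A B C
  proof -
    obtain p q r where pqr: "L p" "L q" "L r" and c: "A = ?c p" "B = ?c q" "C = ?c r"
      using rep[OF ABC(1)] rep[OF ABC(2)] rep[OF ABC(3)] by blast
    then have "homotopic_paths X (p +++ (q +++ r)) ((p +++ q) +++ r)"
      by (intro homotopic_paths_assoc) (auto simp: L_def)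
    then have "?c (p +++ (q +++ r)) = ?c ((p +++ q) +++ r)" by (rule loop_class_cong)
    then show ?thesis by (simp add: c mul Lj pqr)
  qed
  text \<open>The unit and inverse laws are transported from \<open>{0..1}\<close> along the loop itself.\<close>
  have push: "homotopic_paths X (p \<circ> u) (p \<circ> v)" if "L p" "homotopic_paths {0..1} u v" for p u v
    using that by (intro homotopic_paths_continuous_image[where S = "{0..1}"])
      (auto simp: L_def path_def path_image_def)
  show "\<one>\<^bsub>?G\<^esub> \<otimes>\<^bsub>?G\<^esub> A = A" if A: "A \<in> carrier ?G" for A
  proof -
    obtain p where p: "L p" "A = ?c p" using rep[OF A] by blast
    have "homotopic_paths {0..1::real} (linepath 0 0 +++ linepath 0 1) (linepath 0 1)"
      by (rule homotopic_paths_lid') (auto simp: closed_segment_eq_real_ivl)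
    then have "homotopic_paths X (p \<circ> (linepath 0 0 +++ linepath 0 1)) (p \<circ> linepath 0 1)"
      by (rule push[OF p(1)])
    moreover have "p \<circ> (linepath 0 0 +++ linepath 0 1) = (\<lambda>t. x0) +++ p"
      using p by (auto simp: L_def joinpaths_def linepath_def pathstart_def fun_eq_iff)
    moreover have "p \<circ> linepath 0 1 = p" by (auto simp: linepath_def fun_eq_iff)
    ultimately have "?c ((\<lambda>t. x0) +++ p) = ?c p" by (simp add: loop_class_cong)
    then show ?thesis by (simp add: one p mul L1)
  qed
  show "\<exists>B\<in>carrier ?G. B \<otimes>\<^bsub>?G\<^esub> A = \<one>\<^bsub>?G\<^esub>" if A: "A \<in> carrier ?G" for A
  proof -
    obtain p where p: "L p" "A = ?c p" using rep[OF A] by blast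
    have Lr: "L (reversepath p)" using p by (auto simp: L_def)
    have "homotopic_paths {0..1::real} (reversepath (linepath 0 1) +++ linepath 0 1)
        (linepath (pathfinish (linepath 0 1)) (pathfinish (linepath 0 1)))"
      by (rule homotopic_paths_linv) (auto simp: closed_segment_eq_real_ivl)
    then have "homotopic_paths X (p \<circ> (reversepath (linepath 0 1) +++ linepath 0 1)) (p \<circ> linepath 1 1)"
      by (intro push[OF p(1)]) simp
    moreover have "p \<circ> (reversepath (linepath 0 1) +++ linepath 0 1) = reversepath p +++ p"
      by (auto simp: joinpaths_def linepath_def reversepath_def fun_eq_iff)
    moreover have "p \<circ> linepath 1 1 = (\<lambda>t. x0)"
      using p by (auto simp: L_def linepath_def pathfinish_def fun_eq_iff)
    ultimately have "?c (reversepath p +++ p) = ?c (\<lambda>t. x0)" by (simp add: loop_class_cong)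
    then have "?c (reversepath p) \<otimes>\<^bsub>?G\<^esub> A = \<one>\<^bsub>?G\<^esub>"
      by (simp add: one p mul Lr)
    then show ?thesis using car[OF Lr] by blast
  qed
qed


section \<open>Groups with a topology\<close>

definition quasitopological_group :: "('a, 'b) monoid_scheme \<Rightarrow> 'a topology \<Rightarrow> bool" where
  "quasitopological_group G T \<longleftrightarrow>
     group G \<and> topspace T = carrier G \<and>
     continuous_map T T (\<lambda>x. inv\<^bsub>G\<^esub> x) \<and>
     (\<forall>a\<in>carrier G. continuous_map T T (\<lambda>x. a \<otimes>\<^bsub>G\<^esub> x) \<and> continuous_map T T (\<lambda>x. x \<otimes>\<^bsub>G\<^esub> a))"

definition topological_group :: "('a, 'b) monoid_scheme \<Rightarrow> 'a topology \<Rightarrow> bool" where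
  "topological_group G T \<longleftrightarrow>
     group G \<and> topspace T = carrier G \<and>
     continuous_map T T (\<lambda>x. inv\<^bsub>G\<^esub> x) \<and>
     continuous_map (prod_topology T T) T (\<lambda>(x, y). x \<otimes>\<^bsub>G\<^esub> y)"

definition k_omega_space :: "'a topology \<Rightarrow> bool" where
  "k_omega_space T \<longleftrightarrow>
     (\<exists>Y :: nat \<Rightarrow> 'a set.
        (\<forall>n. compactin T (Y n)) \<and> (\<forall>n. Y n \<subseteq> Y (Suc n)) \<and> (\<Union>n. Y n) = topspace T \<and>
        (\<forall>C. C \<subseteq> topspace T \<longrightarrow>
           (closedin T C \<longleftrightarrow> (\<forall>n. closedin (subtopology T (Y n)) (C \<inter> Y n)))))"

definition k_omega_group :: "('a, 'b) monoid_scheme \<Rightarrow> 'a topology \<Rightarrow> bool" where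
  "k_omega_group G T \<longleftrightarrow> quasitopological_group G T \<and> k_omega_space T"

definition T4_space :: "'a topology \<Rightarrow> bool" where
  "T4_space T \<longleftrightarrow> normal_space T \<and> Hausdorff_space T"

end

theory Submission
  imports Defs
begin

text \<open>The loop space of a metric space is metrizable, hence a k-space, although its square need not map
  onto the square of the fundamental group by a quotient map.  Since the product of a quotient map with
  the identity of a compact Hausdorff space is a quotient map, one can descend in one variable at a time:
  multiplication is continuous on \<open>\<pi>\<^sub>1 \<times> K\<close> for every compact \<open>K\<close>.  For a Hausdorff \<open>k\<^sub>\<omega>\<close>-space the square carries the weak topology of the
  squares of the compact pieces, so multiplication is jointly continuous.  Normality is a property of
  every Hausdorff \<open>k\<^sub>\<omega>\<close>-space; it comes from the same inductive construction of open rectangles.\<close>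

subsection \<open>Products and separation in \<open>k\<^sub>\<omega>\<close>-spaces\<close>

text \<open>The weak topology is tested on open sets instead of closed ones because the
  constructions below produce open sets as increasing unions.\<close>

definition k_omega_exhaustion :: "'a topology \<Rightarrow> (nat \<Rightarrow> 'a set) \<Rightarrow> bool" where
  "k_omega_exhaustion T Y \<longleftrightarrow>
     (\<forall>n. compactin T (Y n)) \<and> incseq Y \<and> (\<Union>n. Y n) = topspace T \<and>
     (\<forall>U. U \<subseteq> topspace T \<longrightarrow> (\<forall>n. openin (subtopology T (Y n)) (U \<inter> Y n)) \<longrightarrow> openin T U)"

lemma k_omega_space_imp_exhaustion:
  assumes "k_omega_space T"
  obtains Y where "k_omega_exhaustion T Y"
proof -
  obtain Y where Y: "\<And>n. compactin T (Y n)" "\<And>n. Y n \<subseteq> Y (Suc n)" "(\<Union>n. Y n) = topspace T"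
    and closed: "\<And>C. C \<subseteq> topspace T \<Longrightarrow>
      (\<And>n. closedin (subtopology T (Y n)) (C \<inter> Y n)) \<Longrightarrow> closedin T C"
    using assms unfolding k_omega_space_def by metis
  have "openin T U"
    if U: "U \<subseteq> topspace T" "\<And>n. openin (subtopology T (Y n)) (U \<inter> Y n)" for U
  proof -
    have "closedin T (topspace T - U)"
    proof (rule closed)
      fix n
      have "(topspace T - U) \<inter> Y n = topspace (subtopology T (Y n)) - U \<inter> Y n"
        using compactin_subset_topspace[OF Y(1)] by auto
      then show "closedin (subtopology T (Y n)) ((topspace T - U) \<inter> Y n)"
        using U(2) by (metis closedin_diff closedin_topspace closedin_def openin_closedin_eq)
    qed auto
    then show ?thesis using U(1) by (simp add: openin_closedin_eq)
  qed
  then have "k_omega_exhaustion T Y"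
    using Y by (auto simp: k_omega_exhaustion_def incseq_Suc_iff)
  then show thesis by (rule that)
qed

context
  fixes T :: "'a topology" and Y :: "nat \<Rightarrow> 'a set"
  assumes T: "Hausdorff_space T" and Y: "k_omega_exhaustion T Y"
begin

private abbreviation (input) Z where "Z n \<equiv> subtopology T (Y n)"

private abbreviation (input) cl where "cl n \<equiv> Abstract_Topology.closure_of (Z n)"

private lemma Y_mono: "m \<le> n \<Longrightarrow> Y m \<subseteq> Y n"
  using Y by (simp add: k_omega_exhaustion_def incseqD)

private lemma Y_subset: "Y n \<subseteq> topspace T"
  using Y by (simp add: k_omega_exhaustion_def compactin_subset_topspace)

private lemma topspace_Z: "topspace (Z n) = Y n"
  using Y_subset by auto

private lemma Y_pair:
  assumes "x \<in> topspace T" "y \<in> topspace T"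
  obtains n where "x \<in> Y n" "y \<in> Y n"
proof -
  have "topspace T = (\<Union>n. Y n)"
    using Y by (simp add: k_omega_exhaustion_def)
  then obtain k l where "x \<in> Y k" "y \<in> Y l" using assms by blast
  then show thesis
    using that[of "k + l"] Y_mono[of k "k + l"] Y_mono[of l "k + l"] by auto
qed

private lemma compact_Z: "compact_space (Z n)"
  using Y by (simp add: k_omega_exhaustion_def compact_space_subtopology)

private lemma Hausdorff_Z: "Hausdorff_space (Z n)"
  using T by (rule Hausdorff_space_subtopology)

private lemma normal_Z: "normal_space (Z n)"
  using compact_Z Hausdorff_Z compact_Hausdorff_or_regular_imp_normal_space by blast

text \<open>Each \<open>U n\<close> is open only in its own piece, not in \<open>T\<close>.
  Monotonicity lets the trace of the union on \<open>Y n\<close> be computed from the late members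
  \<open>U (n + k)\<close>, whose pieces contain \<open>Y n\<close>.\<close>

lemma openin_k_omega_Union:
  assumes "\<And>n. openin (Z (n + N)) (U n)" "incseq U"
  shows "openin T (\<Union>n. U n)"
proof -
  have sub: "U n \<subseteq> Y (n + N)" for n
    using openin_subset[OF assms(1)] topspace_Z by blast
  have "openin (Z n) ((\<Union>n. U n) \<inter> Y n)" for n
  proof -
    have "U k \<subseteq> U (n + k)" for k
      using incseqD[OF assms(2)] by simp
    then have "(\<Union>n. U n) \<inter> Y n = (\<Union>k. U (n + k) \<inter> Y n)"
      by blast
    moreover have "openin (Z n) (U (n + k) \<inter> Y n)" for k
    proof -
      have "openin (subtopology (Z (n + k + N)) (Y n)) (U (n + k) \<inter> Y n)"
        using assms(1) by (rule openin_subtopology_Int)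
      then show ?thesis
        using Y_mono[of n "n + k + N"] by (simp add: subtopology_subtopology inf.absorb2)
    qed
    ultimately show ?thesis by (metis (no_types, lifting) openin_Union image_iff)
  qed
  moreover have "(\<Union>n. U n) \<subseteq> topspace T" using sub Y_subset by blast
  ultimately show ?thesis using Y by (simp add: k_omega_exhaustion_def)
qed

text \<open>Wallace's theorem encloses the compact rectangle in an open one, and normality of the
  compact Hausdorff piece shrinks its sides. The closures are kept inside \<open>W\<close> because
  they are compact and can be enclosed again in the next piece.\<close>

private lemma compact_rectangle_shrink:
  assumes "openin (prod_topology (Z n) (Z n)) W" "closedin (Z n) K" "closedin (Z n) L" "K \<times> L \<subseteq> W"
  obtains A B where "openin (Z n) A" "openin (Z n) B" "K \<subseteq> A" "L \<subseteq> B"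
    "cl n A \<times> cl n B \<subseteq> W"
proof -
  have "compactin (Z n) K" "compactin (Z n) L"
    using assms compact_Z closedin_compact_space by blast+
  then obtain U V where "openin (Z n) U" "openin (Z n) V" "K \<subseteq> U" "L \<subseteq> V" and UV: "U \<times> V \<subseteq> W"
    using Wallace_theorem_prod_topology assms(1,4) by metis
  then obtain A B where "openin (Z n) A" "K \<subseteq> A" "cl n A \<subseteq> U"
    "openin (Z n) B" "L \<subseteq> B" "cl n B \<subseteq> V"
    using normal_Z[of n] assms(2,3) unfolding normal_space_alt by metis
  with UV show thesis by (intro that) (auto intro: order.trans[OF Sigma_mono])
qed

text \<open>The last two assumptions keep the product inside \<open>W\<close> when the next pieces of the possibly
  noncompact sets \<open>C\<close> and \<open>D\<close> are added to the rectangle already built on \<open>Y n\<close>.\<close>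

proposition k_omega_rectangle:
  assumes C: "closedin T C" and D: "closedin T D"
    and W: "\<And>n. openin (prod_topology (Z n) (Z n)) (W \<inter> Y n \<times> Y n)"
    and CD: "C \<times> D \<subseteq> W"
    and WD: "\<And>x y d. (x, y) \<in> W \<Longrightarrow> d \<in> D \<Longrightarrow> (x, d) \<in> W"
    and WC: "\<And>x y c. (x, y) \<in> W \<Longrightarrow> c \<in> C \<Longrightarrow> (c, y) \<in> W"
  obtains U V where "openin T U" "openin T V" "C \<subseteq> U" "D \<subseteq> V" "U \<times> V \<subseteq> W"
proof (cases "C = {} \<or> D = {}")
  case True
  then show thesis
    using that[of "{}" "topspace T"] that[of "topspace T" "{}"] closedin_subset[OF C] closedin_subset[OF D]
    by auto
next
  case False
  then obtain c d where cd: "c \<in> C" "d \<in> D" by blast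
  then have "c \<in> topspace T" "d \<in> topspace T"
    using closedin_subset[OF C] closedin_subset[OF D] by blast+
  \<comment> \<open>Shifting all indices by \<open>N\<close> puts \<open>c\<close> and
    \<open>d\<close> into every piece used, so no rectangle of the construction has an empty
    side.\<close>
  then obtain N where "c \<in> Y N" "d \<in> Y N" by (rule Y_pair)
  then have cdN: "c \<in> Y (n + N)" "d \<in> Y (n + N)" for n
    using Y_mono[of N "n + N"] by auto
  define P where "P n = (\<lambda>(A, B). openin (Z (n + N)) A \<and> openin (Z (n + N)) B \<and>
    C \<inter> Y (n + N) \<subseteq> A \<and> D \<inter> Y (n + N) \<subseteq> B \<and>
    cl (n + N) A \<times> cl (n + N) B \<subseteq> W)" for n
  have CY: "closedin (Z n) (C \<inter> Y n)" and DY: "closedin (Z n) (D \<inter> Y n)" for n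
    using C D by (auto simp: closedin_subtopology)
  have extend: "\<exists>R. P n R \<and> K \<subseteq> fst R \<and> L \<subseteq> snd R"
    if "closedin (Z (n + N)) K" "closedin (Z (n + N)) L"
      and KL: "(K \<union> C \<inter> Y (n + N)) \<times> (L \<union> D \<inter> Y (n + N)) \<subseteq> W" for n K L
  proof -
    let ?K = "K \<union> C \<inter> Y (n + N)" and ?L = "L \<union> D \<inter> Y (n + N)"
    have cl: "closedin (Z (n + N)) ?K" "closedin (Z (n + N)) ?L"
      using that CY DY by (auto intro: closedin_Un)
    then have "?K \<subseteq> Y (n + N)" "?L \<subseteq> Y (n + N)"
      using closedin_subset topspace_Z by metis+
    then have "?K \<times> ?L \<subseteq> W \<inter> Y (n + N) \<times> Y (n + N)"
      using KL by blast
    from compact_rectangle_shrink[OF W cl this]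
    obtain A B where "openin (Z (n + N)) A" "openin (Z (n + N)) B" "?K \<subseteq> A" "?L \<subseteq> B"
      "cl (n + N) A \<times> cl (n + N) B \<subseteq> W \<inter> Y (n + N) \<times> Y (n + N)" .
    then show ?thesis by (intro exI[of _ "(A, B)"]) (simp add: P_def)
  qed
  have base: "\<exists>R. P 0 R"
    using extend[of 0 "{}" "{}"] CD by auto
  have step: "\<exists>R'. P (Suc n) R' \<and> fst R \<subseteq> fst R' \<and> snd R \<subseteq> snd R'" if R: "P n R" for R n
  proof -
    let ?K = "cl (n + N) (fst R)" and ?L = "cl (n + N) (snd R)"
    have R: "openin (Z (n + N)) (fst R)" "openin (Z (n + N)) (snd R)" "?K \<times> ?L \<subseteq> W"
      "C \<inter> Y (n + N) \<subseteq> fst R" "D \<inter> Y (n + N) \<subseteq> snd R"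
      using R by (auto simp: P_def)
    then have sub: "fst R \<subseteq> ?K" "snd R \<subseteq> ?L"
      by (simp_all only: closure_of_subset openin_subset)
    then have "c \<in> ?K" "d \<in> ?L"
      using R(4,5) cd cdN[of n] by blast+
    \<comment> \<open>For \<open>x\<close> in \<open>?K\<close> the pair \<open>(x, d)\<close> lies
      in \<open>W\<close>, and \<open>WD\<close> exchanges \<open>d\<close> for any other point of
      \<open>D\<close>; \<open>WC\<close> does the same for \<open>c\<close>. Hence all new points
      of \<open>C\<close> and \<open>D\<close> may be added.\<close>
    then have "\<And>x y. x \<in> ?K \<Longrightarrow> y \<in> D \<Longrightarrow> (x, y) \<in> W" "\<And>x y. x \<in> C \<Longrightarrow> y \<in> ?L \<Longrightarrow> (x, y) \<in> W"
      using R(3) WD WC by blast+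
    then have "(?K \<union> C \<inter> Y (Suc n + N)) \<times> (?L \<union> D \<inter> Y (Suc n + N)) \<subseteq> W"
      using R(3) CD by blast
    \<comment> \<open>A set closed in one piece is compact, hence closed in the Hausdorff space
      \<open>T\<close> and therefore in the next piece.\<close>
    moreover have "closedin (Z (Suc n + N)) (cl (n + N) S)" for S
    proof -
      have "compactin T (cl (n + N) S)"
        using closedin_compact_space[OF compact_Z closedin_closure_of]
        by (meson compactin_subtopology)
      then have "closedin T (cl (n + N) S)"
        using T compactin_imp_closedin by blast
      moreover have "cl (n + N) S \<subseteq> Y (Suc n + N)"
        using closure_of_subset_topspace[of "Z (n + N)"] Y_mono[of "n + N" "Suc n + N"]
        unfolding topspace_Z by fastforce
      ultimately show ?thesis by (rule closedin_subset_topspace)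
    qed
    ultimately show ?thesis
      using extend[of "Suc n" ?K ?L] sub by (meson order.trans)
  qed
  obtain R where R: "\<And>n. P n (R n)" "\<And>n. fst (R n) \<subseteq> fst (R (Suc n)) \<and> snd (R n) \<subseteq> snd (R (Suc n))"
    using dependent_nat_choice[of P "\<lambda>_ R R'. fst R \<subseteq> fst R' \<and> snd R \<subseteq> snd R'", OF base step] by metis
  define A B where "A n = fst (R n)" and "B n = snd (R n)" for n
  have A: "openin (Z (n + N)) (A n)" "C \<inter> Y (n + N) \<subseteq> A n"
    and B: "openin (Z (n + N)) (B n)" "D \<inter> Y (n + N) \<subseteq> B n"
    and closures: "cl (n + N) (A n) \<times> cl (n + N) (B n) \<subseteq> W" for n
    using R(1)[of n] by (auto simp: P_def A_def B_def)
  have mono: "incseq A" "incseq B"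
    using R(2) by (auto simp: incseq_Suc_iff A_def B_def)
  have exh: "x \<in> (\<Union>n. Y (n + N))" if "x \<in> topspace T" for x
  proof -
    from that that obtain n where "x \<in> Y n" "x \<in> Y n" by (rule Y_pair)
    then have "x \<in> Y (n + N)" using Y_mono[of n "n + N"] by auto
    then show ?thesis by blast
  qed
  show thesis
  proof
    show "openin T (\<Union>n. A n)" "openin T (\<Union>n. B n)"
      using openin_k_omega_Union A B mono by blast+
    show "C \<subseteq> (\<Union>n. A n)"
      using exh A(2) closedin_subset[OF C] by fast
    show "D \<subseteq> (\<Union>n. B n)"
      using exh B(2) closedin_subset[OF D] by fast
    have AB: "A n \<times> B n \<subseteq> W" for n
      using Sigma_mono[OF closure_of_subset[OF openin_subset[OF A(1)[of n]]]
        closure_of_subset[OF openin_subset[OF B(1)[of n]]]] closures[of n] by (rule order.trans)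
    \<comment> \<open>Members with different indices are compared at the common later index
      \<open>m + n\<close>.\<close>
    have "(x, y) \<in> W" if "x \<in> A m" "y \<in> B n" for x y m n
    proof -
      have "A m \<subseteq> A (m + n)" "B n \<subseteq> B (m + n)"
        using mono by (simp_all add: incseqD)
      then show ?thesis using that AB[of "m + n"] by blast
    qed
    then show "(\<Union>n. A n) \<times> (\<Union>n. B n) \<subseteq> W" by blast
  qed
qed

lemma normal_space_k_omega: "normal_space T"
  unfolding normal_space_def
proof clarify
  fix C D assume C: "closedin T C" and D: "closedin T D" and CD: "disjnt C D"
  \<comment> \<open>A rectangle inside \<open>W\<close> has disjoint sides, since a common point
    \<open>z\<close> would put \<open>(z, z)\<close> into \<open>W\<close>. Removing
    \<open>D\<close> on the left and \<open>C\<close> on the right makes the exchange conditions of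
    \<open>k_omega_rectangle\<close> hold.\<close>
  define W where "W = (topspace T - D) \<times> (topspace T - C) - (\<lambda>x. (x, x)) ` topspace T"
  have "openin (prod_topology T T) W"
    using C D T unfolding W_def
    by (intro openin_diff) (auto simp: openin_prod_Times_iff Hausdorff_space_closedin_diagonal closedin_def)
  then have W: "openin (prod_topology (Z n) (Z n)) (W \<inter> Y n \<times> Y n)" for n
    unfolding subtopology_Times[symmetric] by (rule openin_subtopology_Int)
  have sub: "C \<subseteq> topspace T" "D \<subseteq> topspace T"
    using C D by (simp_all add: closedin_subset)
  have "C \<times> D \<subseteq> W"
    using sub CD by (auto simp: W_def disjnt_iff)
  moreover have "(x, y) \<in> W \<Longrightarrow> d \<in> D \<Longrightarrow> (x, d) \<in> W" "(x, y) \<in> W \<Longrightarrow> c \<in> C \<Longrightarrow> (c, y) \<in> W" for x y c d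
    using sub CD by (auto simp: W_def disjnt_iff)
  ultimately obtain U V where "openin T U" "openin T V" "C \<subseteq> U" "D \<subseteq> V" "U \<times> V \<subseteq> W"
    using k_omega_rectangle[OF C D W] by metis
  moreover from this have "disjnt U V"
    using openin_subset by (fastforce simp: W_def disjnt_iff)
  ultimately show "\<exists>U V. openin T U \<and> openin T V \<and> C \<subseteq> U \<and> D \<subseteq> V \<and> disjnt U V" by blast
qed

text \<open>The square of \<open>T\<close> carries the weak topology of the squares of the pieces.
  Around each point of \<open>W\<close> an open rectangle is grown with
  \<open>k_omega_rectangle\<close>, starting from two singletons.\<close>

lemma openin_k_omega_prod:
  assumes W: "W \<subseteq> topspace T \<times> topspace T"
    and WZ: "\<And>n. openin (prod_topology (Z n) (Z n)) (W \<inter> Y n \<times> Y n)"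
  shows "openin (prod_topology T T) W"
  unfolding openin_prod_topology_alt
proof (intro allI impI)
  fix a b assume ab: "(a, b) \<in> W"
  then have "a \<in> topspace T" "b \<in> topspace T" using W by auto
  then obtain k where k: "a \<in> Y k" "b \<in> Y k" by (rule Y_pair)
  \<comment> \<open>\<open>W\<close> itself need not allow exchanging \<open>y\<close> for
    \<open>b\<close> or \<open>x\<close> for \<open>a\<close>. Cutting down to the pairs whose
    projections to the two axes through \<open>(a, b)\<close> stay in \<open>W\<close> enforces both
    exchanges.\<close>
  define W' where "W' = {(x, y) \<in> W. (x, b) \<in> W \<and> (a, y) \<in> W}"
  have "openin (prod_topology (Z n) (Z n)) (W' \<inter> Y n \<times> Y n)" for n
  proof -
    \<comment> \<open>The slices through \<open>a\<close> and \<open>b\<close> make sense only in a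
      piece containing both points; they are formed in \<open>Y m\<close> and then cut back to
      \<open>Y n\<close>.\<close>
    define m where "m = n + k"
    have m: "a \<in> Y m" "b \<in> Y m" "Y n \<subseteq> Y m"
      using k Y_mono[of k m] Y_mono[of n m] by (auto simp: m_def)
    have ZZ: "subtopology (Z m) (Y n) = Z n"
      using m by (simp add: subtopology_subtopology inf.absorb2)
    have "continuous_map (Z m) (prod_topology (Z m) (Z m)) (\<lambda>x. (x, b))"
      "continuous_map (Z m) (prod_topology (Z m) (Z m)) (\<lambda>y. (a, y))"
      using m topspace_Z[of m] by (auto intro!: continuous_map_pairedI)
    from this[THEN openin_continuous_map_preimage, OF WZ[of m]]
    have "openin (Z m) {x \<in> Y m. (x, b) \<in> W}" "openin (Z m) {y \<in> Y m. (a, y) \<in> W}"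
      using m unfolding topspace_Z by (simp_all cong: conj_cong)
    from this[THEN openin_subtopology_Int, of "Y n"]
    have "openin (Z n) ({x \<in> Y m. (x, b) \<in> W} \<inter> Y n)" "openin (Z n) ({y \<in> Y m. (a, y) \<in> W} \<inter> Y n)"
      unfolding ZZ .
    then have "openin (prod_topology (Z n) (Z n))
        (W \<inter> Y n \<times> Y n \<inter> ({x \<in> Y m. (x, b) \<in> W} \<inter> Y n) \<times> ({y \<in> Y m. (a, y) \<in> W} \<inter> Y n))"
      by (intro openin_Int[OF WZ]) (simp add: openin_prod_Times_iff)
    also have "W \<inter> Y n \<times> Y n \<inter> ({x \<in> Y m. (x, b) \<in> W} \<inter> Y n) \<times> ({y \<in> Y m. (a, y) \<in> W} \<inter> Y n)
        = W' \<inter> Y n \<times> Y n"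
      using m by (auto simp: W'_def)
    finally show ?thesis .
  qed
  moreover have "closedin T {a}" "closedin T {b}"
    using T W ab by (auto intro: closedin_Hausdorff_singleton)
  moreover have "{a} \<times> {b} \<subseteq> W'" using ab by (simp add: W'_def)
  moreover have "(x, y) \<in> W' \<Longrightarrow> d \<in> {b} \<Longrightarrow> (x, d) \<in> W'" "(x, y) \<in> W' \<Longrightarrow> c \<in> {a} \<Longrightarrow> (c, y) \<in> W'"
    for x y c d using ab by (auto simp: W'_def)
  ultimately obtain U V where "openin T U" "openin T V" "{a} \<subseteq> U" "{b} \<subseteq> V" "U \<times> V \<subseteq> W'"
    using k_omega_rectangle[of "{a}" "{b}" W'] by metis
  then show "\<exists>U V. openin T U \<and> openin T V \<and> a \<in> U \<and> b \<in> V \<and> U \<times> V \<subseteq> W"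
    by (intro exI[of _ U] exI[of _ V]) (auto simp: W'_def)
qed

lemma continuous_map_from_k_omega_prod:
  assumes "\<And>n. continuous_map (prod_topology (Z n) (Z n)) S f"
  shows "continuous_map (prod_topology T T) S f"
  unfolding continuous_map
proof (intro conjI allI impI)
  show "f ` topspace (prod_topology T T) \<subseteq> topspace S"
  proof (rule image_subsetI)
    fix z assume "z \<in> topspace (prod_topology T T)"
    then have "fst z \<in> topspace T" "snd z \<in> topspace T" by auto
    then obtain n where "fst z \<in> Y n" "snd z \<in> Y n" by (rule Y_pair)
    then have "z \<in> topspace (prod_topology (Z n) (Z n))"
      unfolding topspace_prod_topology topspace_Z by (simp add: mem_Times_iff)
    then show "f z \<in> topspace S"
      using continuous_map_image_subset_topspace[OF assms] by blast
  qed
  fix U assume U: "openin S U"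
  show "openin (prod_topology T T) {z \<in> topspace (prod_topology T T). f z \<in> U}"
  proof (rule openin_k_omega_prod)
    fix n
    have "openin (prod_topology (Z n) (Z n)) {z \<in> Y n \<times> Y n. f z \<in> U}"
      using openin_continuous_map_preimage[OF assms U, of n] by (simp add: topspace_Z del: topspace_subtopology)
    also have "{z \<in> Y n \<times> Y n. f z \<in> U} = {z \<in> topspace (prod_topology T T). f z \<in> U} \<inter> Y n \<times> Y n"
      using Y_subset by fastforce
    finally show "openin (prod_topology (Z n) (Z n)) \<dots>" .
  qed auto
qed

end

subsection \<open>Metrizability of the loop space\<close>

text \<open>Subbasic sets are open for the uniform metric because an open set contains a uniform
  neighbourhood of a compact image. Conversely, a finite cover of \<open>S\<close> by sets on which
  \<open>f\<close> varies little reduces a uniform ball to finitely many subbasic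
  conditions.\<close>

lemma compact_open_topology_metric:
  assumes S: "compact_space S"
  shows "compact_open_topology S (mtopology_of m) = mtopology_of (cfunspace S m)"
proof -
  let ?C = "cfunspace S m" and ?T = "compact_open_topology S (mtopology_of m)"
  interpret M: Metric_space "mspace m" "mdist m" by (rule Metric_space_mspace_mdist)
  interpret C: Metric_space "mspace ?C" "mdist ?C" by (rule Metric_space_mspace_mdist)
  have Mtop: "mtopology_of m = M.mtopology" and Ctop: "mtopology_of ?C = C.mtopology"
    by (simp_all add: mtopology_of_def)
  have S': "compactin S (topspace S)" using S by (simp add: compact_space_def)
  \<comment> \<open>The boundedness required in \<open>cfunspace\<close> is automatic on the compact
    space \<open>S\<close>.\<close>
  have mC: "f \<in> mspace ?C \<longleftrightarrow> f \<in> extensional (topspace S) \<and> continuous_map S M.mtopology f" for f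
    unfolding compactin_mspace_cfunspace[OF S'] Mtop
    using continuous_map_image_subset_topspace[of S M.mtopology f] by auto
  note mspace_cfunspace [simp del]
  have topT: "topspace ?T = mspace ?C"
    by (auto simp: topspace_compact_open_topology mC Mtop)
  have fM: "f x \<in> mspace m" if "f \<in> mspace ?C" "x \<in> topspace S" for f x
    using that by (simp add: compactin_mspace_cfunspace[OF S'])
  have sub: "openin C.mtopology {f \<in> extensional (topspace S). continuous_map S M.mtopology f \<and> f ` K \<subseteq> U}"
    if K: "compactin S K" and U: "openin M.mtopology U" for K U
    unfolding C.openin_mtopology
  proof (intro conjI allI impI)
    fix f assume f: "f \<in> {f \<in> extensional (topspace S). continuous_map S M.mtopology f \<and> f ` K \<subseteq> U}"
    then have fC: "f \<in> mspace ?C" by (simp add: mC)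
    have KS: "K \<subseteq> topspace S" using K by (rule compactin_subset_topspace)
    have "compactin M.mtopology (f ` K)" using f K image_compactin by blast
    \<comment> \<open>The Lebesgue number of the one-member cover \<open>{U}\<close> gives one
      radius for all points of the image.\<close>
    then obtain e where e: "e > 0" "\<And>x. x \<in> f ` K \<Longrightarrow> M.mball x e \<subseteq> U"
      using M.lebesgue_number[of "f ` K" "{U}"] f U by auto
    have "C.mball f e \<subseteq> {f \<in> extensional (topspace S). continuous_map S M.mtopology f \<and> f ` K \<subseteq> U}"
    proof
      fix g assume g: "g \<in> C.mball f e"
      then have gC: "g \<in> mspace ?C" and d: "mdist ?C f g < e" by auto
      have "g x \<in> U" if "x \<in> K" for x
      proof -
        have "mdist m (f x) (g x) < e"
          using cfunspace_mdist_lt[OF S' fC gC d] KS that by blast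
        then have "g x \<in> M.mball (f x) e" using fM fC gC KS that by auto
        then show ?thesis using e(2) that by blast
      qed
      then show "g \<in> {f \<in> extensional (topspace S). continuous_map S M.mtopology f \<and> f ` K \<subseteq> U}"
        using gC by (auto simp: mC)
    qed
    then show "\<exists>r>0. C.mball f r \<subseteq> {f \<in> extensional (topspace S). continuous_map S M.mtopology f \<and> f ` K \<subseteq> U}"
      using e(1) by blast
  qed (auto simp: mC)
  have "openin C.mtopology V" if "openin ?T V" for V
    using that[unfolded compact_open_topology_def openin_topology_generated_by_iff Mtop]
    by (induction) (use sub in auto)
  moreover have "openin ?T V" if V: "openin C.mtopology V" for V
  proof (subst openin_subopen, intro ballI)
    fix f assume "f \<in> V"
    then obtain e where e: "e > 0" "C.mball f e \<subseteq> V" and f: "f \<in> mspace ?C"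
      using V unfolding C.openin_mtopology by blast
    have fc: "continuous_map S M.mtopology f" using f by (simp add: mC)
    \<comment> \<open>With \<open>f\<close> within \<open>e/4\<close> of \<open>f t\<close> on
      \<open>O' t\<close> and \<open>g\<close> within \<open>e/2\<close> of \<open>f t\<close>
      there, \<open>f\<close> and \<open>g\<close> differ by less than \<open>3 * e / 4\<close>
      pointwise. The slack below \<open>e\<close> survives passing to the supremum.\<close>
    define O' where "O' t = {x \<in> topspace S. f x \<in> M.mball (f t) (e/4)}" for t
    have "openin S (O' t)" for t
      unfolding O'_def by (rule openin_continuous_map_preimage[OF fc]) auto
    moreover have "topspace S \<subseteq> \<Union> (O' ` topspace S)"
      using e fM[OF f] by (auto simp: O'_def)
    ultimately obtain F where F: "finite F" "F \<subseteq> topspace S" "topspace S \<subseteq> \<Union> (O' ` F)"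
      using S' unfolding compactin_def by (metis (no_types, lifting) finite_subset_image imageE)
    \<comment> \<open>The closed balls give compact sets \<open>K t\<close> that contain
      \<open>O' t\<close>, as the subbasis asks for compact sets.\<close>
    define K where "K t = {x \<in> topspace S. f x \<in> M.mcball (f t) (e/4)}" for t
    have K: "compactin S (K t)" for t
      unfolding K_def
      by (intro closedin_compact_space[OF S] closedin_continuous_map_preimage[OF fc]) simp
    define N where "N t = {g \<in> extensional (topspace S). continuous_map S M.mtopology g \<and>
      g ` K t \<subseteq> M.mball (f t) (e/2)}" for t
    have N: "openin ?T (N t)" for t
      unfolding compact_open_topology_def Mtop N_def
      by (rule topology_generated_by_Basis) (use K in blast)
    \<comment> \<open>Inserting the whole space keeps the intersection meaningful when
      \<open>F\<close> is empty, that is, when \<open>S\<close> is empty.\<close>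
    have "openin ?T (\<Inter> (insert (topspace ?T) (N ` F)))"
      using F N by (intro openin_Inter) auto
    moreover have "f \<in> \<Inter> (insert (topspace ?T) (N ` F))"
      using f F e(1) fM[OF f] by (auto simp: N_def K_def mC topT)
    moreover have "\<Inter> (insert (topspace ?T) (N ` F)) \<subseteq> V"
    proof
      fix g assume g: "g \<in> \<Inter> (insert (topspace ?T) (N ` F))"
      then have gC: "g \<in> mspace ?C" by (simp add: topT)
      have "mdist m (f x) (g x) \<le> 3 * e / 4" if x: "x \<in> topspace S" for x
      proof -
        obtain t where t: "t \<in> F" "x \<in> O' t" using F x by blast
        then have "x \<in> K t" by (auto simp: O'_def K_def)
        moreover have "g ` K t \<subseteq> M.mball (f t) (e/2)" using g t(1) by (simp add: N_def)
        ultimately have gx: "g x \<in> M.mball (f t) (e/2)" by blast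
        have "mdist m (f x) (g x) \<le> mdist m (f t) (f x) + mdist m (f t) (g x)"
          using fM[OF f] fM[OF gC] x t F by (metis M.triangle'' subsetD)
        then show ?thesis using gx t by (auto simp: O'_def)
      qed
      then have "mdist ?C f g \<le> 3 * e / 4"
        using e(1) by (intro mdist_cfunspace_le) auto
      then have "g \<in> C.mball f e" using f gC e(1) by auto
      then show "g \<in> V" using e(2) by blast
    qed
    ultimately show "\<exists>U. openin ?T U \<and> f \<in> U \<and> U \<subseteq> V" by blast
  qed
  ultimately show ?thesis unfolding Ctop topology_eq by blast
qed

lemma metrizable_loop_space:
  fixes X :: "'a::metric_space set"
  shows "metrizable_space (loop_space X x0)"
proof -
  have "compact_space (top_of_set {0..1::real})"
    by (simp add: compact_space_subtopology)
  then have "compact_open_topology (top_of_set {0..1::real}) (top_of_set X)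
      = mtopology_of (cfunspace (top_of_set {0..1}) (submetric euclidean_metric X))"
    using compact_open_topology_metric[of _ "submetric euclidean_metric X"]
    by (simp add: mtopology_of_submetric)
  then show ?thesis
    unfolding loop_space_def
    by (metis Metric_space.metrizable_space_mtopology Metric_space_mspace_mdist
        metrizable_space_subtopology mtopology_of_def)
qed

section \<open>Continuity of loop concatenation\<close>

lemma openin_loop_space_subbasis:
  assumes "compact K" "K \<subseteq> {0..1}" "openin (top_of_set X) U"
  shows "openin (loop_space X x0) {p \<in> topspace (loop_space X x0). p ` K \<subseteq> U}"
proof -
  have "openin (compact_open_topology (top_of_set {0..1}) (top_of_set X))
      {f \<in> extensional {0..1}. continuous_map (top_of_set {0..1}) (top_of_set X) f \<and> f ` K \<subseteq> U}"
    unfolding compact_open_topology_def using assms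
    by (intro topology_generated_by_Basis) (auto simp: compactin_subtopology)
  from openin_subtopology_Int[OF this, of "{p. pathstart p = x0 \<and> pathfinish p = x0}"]
  have "openin (loop_space X x0)
      ({f \<in> extensional {0..1}. continuous_map (top_of_set {0..1}) (top_of_set X) f \<and> f ` K \<subseteq> U}
        \<inter> {p. pathstart p = x0 \<and> pathfinish p = x0})"
    by (simp add: loop_space_def)
  then show ?thesis
    by (rule back_subst[of "openin (loop_space X x0)"])
      (auto simp: loop_space_def topspace_compact_open_topology)
qed

text \<open>The restriction makes the concatenation extensional, hence an actual point of the loop
  space.\<close>

definition loop_join :: "(real \<Rightarrow> 'a::topological_space) \<Rightarrow> (real \<Rightarrow> 'a) \<Rightarrow> real \<Rightarrow> 'a" where
  "loop_join p q = restrict (p +++ q) {0..1}"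

lemma homotopic_paths_loop_join:
  assumes "p \<in> topspace (loop_space X x0)" "q \<in> topspace (loop_space X x0)"
  shows "homotopic_paths X (p +++ q) (loop_join p q)"
  using assms by (intro homotopic_paths_eq) (auto simp: topspace_loop_space path_image_join loop_join_def)

lemma loop_join_in_loop_space:
  assumes "p \<in> topspace (loop_space X x0)" "q \<in> topspace (loop_space X x0)"
  shows "loop_join p q \<in> topspace (loop_space X x0)"
  using homotopic_paths_loop_join[OF assms, THEN homotopic_paths_imp_path]
    homotopic_paths_loop_join[OF assms, THEN homotopic_paths_imp_subset]
    homotopic_paths_loop_join[OF assms, THEN homotopic_paths_imp_pathstart]
    homotopic_paths_loop_join[OF assms, THEN homotopic_paths_imp_pathfinish] assms
  by (simp add: topspace_loop_space) (simp add: loop_join_def)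

text \<open>The concatenation maps \<open>K\<close> into \<open>U\<close> exactly when each loop
  maps its rescaled half of \<open>K\<close> into \<open>U\<close>. So the preimage of a subbasic
  set is a product of two subbasic sets.\<close>

lemma continuous_map_loop_join:
  "continuous_map (prod_topology (loop_space X x0) (loop_space X x0)) (loop_space X x0)
     (\<lambda>(p, q). loop_join p q)"
proof -
  let ?L = "loop_space X x0"
  have "continuous_map (prod_topology ?L ?L) (compact_open_topology (top_of_set {0..1}) (top_of_set X))
     (\<lambda>(p, q). loop_join p q)"
    unfolding compact_open_topology_def
  proof (rule continuous_on_generated_topo)
    let ?B = "\<lambda>K U. {f \<in> extensional (topspace (top_of_set {0..1::real})).
      continuous_map (top_of_set {0..1}) (top_of_set X) f \<and> f ` K \<subseteq> U}"
    fix V assume "V \<in> {?B K U |K U. compactin (top_of_set {0..1}) K \<and> openin (top_of_set X) U}"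
    then obtain K U where V: "V = ?B K U" and K: "compact K" "K \<subseteq> {0..1}" and U: "openin (top_of_set X) U"
      by (auto simp: compactin_subtopology)
    define K1 where "K1 = (\<lambda>t. 2 * t) ` (K \<inter> {0..1/2})"
    define K2 where "K2 = (\<lambda>t. 2 * t - 1) ` (K \<inter> {1/2..1})"
    have K1: "compact K1" "K1 \<subseteq> {0..1}" and K2: "compact K2" "K2 \<subseteq> {0..1}"
      using K unfolding K1_def K2_def
      by (auto intro!: compact_continuous_image continuous_intros compact_Int)
    have "loop_join p q \<in> V \<longleftrightarrow> p ` K1 \<subseteq> U \<and> q ` K2 \<subseteq> U"
      if pq: "p \<in> topspace ?L" "q \<in> topspace ?L" for p q
    proof -
      have "loop_join p q \<in> V \<longleftrightarrow> loop_join p q ` K \<subseteq> U"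
        using loop_join_in_loop_space[OF pq]
        by (auto simp: V loop_space_def topspace_compact_open_topology)
      also have "\<dots> \<longleftrightarrow> p ` K1 \<subseteq> U \<and> q ` K2 \<subseteq> U"
      proof -
        \<comment> \<open>At \<open>1/2\<close>, which belongs to both halves, \<open>+++\<close>
          evaluates the first loop; the common base point makes the second formula valid there
          too.\<close>
        have join: "p 1 = q 0"
          using pq by (simp add: topspace_loop_space pathstart_def pathfinish_def)
        have "loop_join p q t = p (2 * t)" if "t \<in> K \<inter> {0..1/2}" for t
          using that K by (auto simp: loop_join_def joinpaths_def)
        moreover have "loop_join p q t = q (2 * t - 1)" if "t \<in> K \<inter> {1/2..1}" for t
        proof (cases "t = 1/2")
          case True
          show ?thesis unfolding True using join by (simp add: loop_join_def joinpaths_def)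
        next
          case False
          then show ?thesis using that K by (auto simp: loop_join_def joinpaths_def)
        qed
        moreover have "K = (K \<inter> {0..1/2}) \<union> (K \<inter> {1/2..1})"
          using K by auto
        then have "loop_join p q ` K = loop_join p q ` (K \<inter> {0..1/2}) \<union> loop_join p q ` (K \<inter> {1/2..1})"
          by blast
        ultimately show ?thesis by (simp add: K1_def K2_def image_image)
      qed
      finally show ?thesis .
    qed
    then have iff: "z \<in> (\<lambda>(p, q). loop_join p q) -` V \<inter> topspace (prod_topology ?L ?L) \<longleftrightarrow>
        z \<in> {p \<in> topspace ?L. p ` K1 \<subseteq> U} \<times> {q \<in> topspace ?L. q ` K2 \<subseteq> U}" for z
      by (cases z) (simp only: vimage_eq Int_iff mem_Collect_eq mem_Sigma_iff prod.case topspace_prod_topology; blast)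
    have "(\<lambda>(p, q). loop_join p q) -` V \<inter> topspace (prod_topology ?L ?L) =
        {p \<in> topspace ?L. p ` K1 \<subseteq> U} \<times> {q \<in> topspace ?L. q ` K2 \<subseteq> U}"
      by (rule Set.set_eqI) (rule iff)
    then show "openin (prod_topology ?L ?L) ((\<lambda>(p, q). loop_join p q) -` V \<inter> topspace (prod_topology ?L ?L))"
      using openin_loop_space_subbasis[OF K1 U, of x0] openin_loop_space_subbasis[OF K2 U, of x0]
      by (simp only: openin_prod_Times_iff simp_thms)
  next
    show "(\<lambda>(p, q). loop_join p q) ` topspace (prod_topology ?L ?L) \<subseteq>
      \<Union> {{f \<in> extensional (topspace (top_of_set {0..1::real})).
          continuous_map (top_of_set {0..1}) (top_of_set X) f \<and> f ` K \<subseteq> U} |K U.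
          compactin (top_of_set {0..1}) K \<and> openin (top_of_set X) U}"
      unfolding topology_generated_by_topspace[symmetric] compact_open_topology_def[symmetric]
      using loop_join_in_loop_space[of _ X x0] by (auto simp: loop_space_def)
  qed
  moreover have "(\<lambda>(p, q). loop_join p q) \<in> topspace (prod_topology ?L ?L) \<rightarrow>
      {p. pathstart p = x0 \<and> pathfinish p = x0}"
    using loop_join_in_loop_space[of _ X x0] by (auto simp: topspace_loop_space)
  ultimately show ?thesis
    by (subst (3) loop_space_def) (simp add: continuous_map_in_subtopology image_subset_iff_funcset)
qed

lemma loop_class_loop_join:
  assumes "p \<in> topspace (loop_space X x0)" "q \<in> topspace (loop_space X x0)"
  shows "loop_class X x0 (loop_join p q) =
    loop_class X x0 p \<otimes>\<^bsub>fundamental_group X x0\<^esub> loop_class X x0 q"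
proof -
  have "loop_class X x0 (loop_join p q) = loop_class X x0 (p +++ q)"
    using homotopic_paths_loop_join[OF assms] by (simp add: loop_class_cong)
  then show ?thesis
    using assms by (simp add: fundamental_group_mult topspace_loop_space)
qed

section \<open>Descent of continuity along quotient maps\<close>

lemma continuous_map_from_k_space_prod:
  assumes X: "k_space X" and Y: "compact_space Y" "Hausdorff_space Y"
    and f: "\<And>K. compactin X K \<Longrightarrow> continuous_map (prod_topology (subtopology X K) Y) Z f"
  shows "continuous_map (prod_topology X Y) Z f"
proof (rule continuous_map_from_k_space)
  show "k_space (prod_topology X Y)"
    using X Y by (simp add: k_space_prod_topology_right compact_imp_locally_compact_space)
  fix C assume C: "compactin (prod_topology X Y) C"
  then have "compactin X (fst ` C)"
    using image_compactin continuous_map_fst by blast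
  then have "continuous_map (subtopology (prod_topology X Y) (fst ` C \<times> topspace Y)) Z f"
    using f by (simp add: subtopology_Times)
  moreover have "C \<subseteq> fst ` C \<times> topspace Y"
    using compactin_subset_topspace[OF C] by force
  ultimately show "continuous_map (subtopology (prod_topology X Y) C) Z f"
    by (rule continuous_map_from_subtopology_mono)
qed

lemma continuous_map_quotient_prod_compact:
  assumes q: "quotient_map L G q" and L: "k_space L" "Hausdorff_space L"
    and Y: "compactin G Y" and G: "Hausdorff_space G"
    and f: "continuous_map (prod_topology L L) Z (\<lambda>(x, y). f (q x, q y))"
  shows "continuous_map (prod_topology G (subtopology G Y)) Z f"
proof -
  let ?Y = "subtopology G Y"
  have Y': "compact_space ?Y" "Hausdorff_space ?Y"
    using Y G by (simp_all add: compact_space_subtopology Hausdorff_space_subtopology)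
  \<comment> \<open>First only the second variable descends. Over a compact \<open>K\<close> in
    \<open>L\<close> the map \<open>q\<close> times the identity of \<open>K\<close> is a quotient
    map; the preceding lemma then passes from all such \<open>K\<close> to \<open>L\<close>.\<close>
  have "continuous_map (prod_topology L ?Y) Z (\<lambda>(x, b). f (q x, b))"
  proof (rule continuous_map_from_k_space_prod[OF L(1) Y'])
    fix K assume K: "compactin L K"
    let ?K = "subtopology L K"
    have "quotient_map (prod_topology ?K L) (prod_topology ?K G) (\<lambda>(x, y). (x, q y))"
      using K L q by (intro quotient_map_prod_right)
        (simp_all add: compact_space_subtopology compact_imp_locally_compact_space Hausdorff_space_subtopology)
    moreover have "continuous_map (prod_topology ?K L) Z ((\<lambda>(x, b). f (q x, b)) \<circ> (\<lambda>(x, y). (x, q y)))"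
      using continuous_map_from_subtopology[OF f]
      by (simp add: prod_topology_subtopology o_def case_prod_unfold)
    ultimately have "continuous_map (prod_topology ?K G) Z (\<lambda>(x, b). f (q x, b))"
      by (rule continuous_compose_quotient_map)
    then show "continuous_map (prod_topology ?K ?Y) Z (\<lambda>(x, b). f (q x, b))"
      by (simp add: prod_topology_subtopology continuous_map_from_subtopology)
  qed
  then have "continuous_map (prod_topology L ?Y) Z (f \<circ> (\<lambda>(x, b). (q x, b)))"
    by (simp add: o_def case_prod_unfold)
  \<comment> \<open>Now the first variable descends, with the compact Hausdorff \<open>?Y\<close> as
    the fixed factor.\<close>
  moreover have "quotient_map (prod_topology L ?Y) (prod_topology G ?Y) (\<lambda>(x, b). (q x, b))"
    using Y' q by (intro quotient_map_prod_left) (simp_all add: compact_imp_locally_compact_space)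
  ultimately show ?thesis using continuous_compose_quotient_map by blast
qed

section \<open>Multiplication in the fundamental group\<close>

lemma continuous_map_pi1_mult_compact:
  fixes X :: "'a::metric_space set"
  assumes "Hausdorff_space (pi1_qtop X x0)" "compactin (pi1_qtop X x0) K"
  shows "continuous_map (prod_topology (pi1_qtop X x0) (subtopology (pi1_qtop X x0) K)) (pi1_qtop X x0)
    (\<lambda>(A, B). A \<otimes>\<^bsub>fundamental_group X x0\<^esub> B)"
proof (rule continuous_map_quotient_prod_compact[OF quotient_map_pi1_qtop])
  let ?L = "loop_space X x0"
  show "k_space ?L" "Hausdorff_space ?L"
    using metrizable_loop_space metrizable_imp_k_space metrizable_imp_Hausdorff_space by blast+
  have "continuous_map (prod_topology ?L ?L) (pi1_qtop X x0) (loop_class X x0 \<circ> (\<lambda>(p, q). loop_join p q))"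
    using continuous_map_loop_join quotient_map_pi1_qtop
    by (blast intro: continuous_map_compose quotient_imp_continuous_map)
  then show "continuous_map (prod_topology ?L ?L) (pi1_qtop X x0)
      (\<lambda>(p, q). case (loop_class X x0 p, loop_class X x0 q) of (A, B) \<Rightarrow> A \<otimes>\<^bsub>fundamental_group X x0\<^esub> B)"
    by (rule continuous_map_eq) (auto simp: loop_class_loop_join)
qed (use assms in auto)

theorem proposition49:
  fixes X :: "'a::metric_space set" and x0 :: 'a
  assumes "path_connected X" and "x0 \<in> X"
    and "Hausdorff_space (pi1_qtop X x0)"
    and "k_omega_group (fundamental_group X x0) (pi1_qtop X x0)"
  shows "topological_group (fundamental_group X x0) (pi1_qtop X x0) \<and>
    (compact X \<longrightarrow> T4_space (pi1_qtop X x0))"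
proof
  let ?G = "fundamental_group X x0" and ?T = "pi1_qtop X x0"
  have G: "quasitopological_group ?G ?T" and "k_omega_space ?T"
    using assms(4) by (simp_all add: k_omega_group_def)
  then obtain Y where Y: "k_omega_exhaustion ?T Y"
    using k_omega_space_imp_exhaustion by blast
  have "continuous_map (prod_topology (subtopology ?T (Y n)) (subtopology ?T (Y n))) ?T
      (\<lambda>(A, B). A \<otimes>\<^bsub>?G\<^esub> B)" for n
  proof -
    have "compactin ?T (Y n)" using Y by (simp add: k_omega_exhaustion_def)
    then show ?thesis
      using continuous_map_pi1_mult_compact[OF assms(3)]
      by (simp add: prod_topology_subtopology(1) continuous_map_from_subtopology)
  qed
  \<comment> \<open>Continuity on the squares of the pieces suffices, as they determine the topology
    of the square of \<open>?T\<close>.\<close>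
  then have "continuous_map (prod_topology ?T ?T) ?T (\<lambda>(A, B). A \<otimes>\<^bsub>?G\<^esub> B)"
    by (rule continuous_map_from_k_omega_prod[OF assms(3) Y])
  then show "topological_group ?G ?T"
    using G by (simp add: quasitopological_group_def topological_group_def)
  show "compact X \<longrightarrow> T4_space ?T"
    using normal_space_k_omega[OF assms(3) Y] assms(3) by (simp add: T4_space_def)
qed

end
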